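(* Let $p:\widetilde{X}\to X$ be a covering (with $X$ and $\widetilde{X}$ path connected), let $x\in X$ and $\tilde{x}\in p^{-1}(\{x\})$. Then $$\pi_1^{bsp}(X,x)\le \pi_1^{sp}(X,x)\le p_*\pi_1(\widetilde{X},\tilde{x}).$$
   Context: A covering $p:\widetilde{X}\to X$ is a continuous map such that every $x\in X$ has an open neighborhood $U$ that is evenly covered, i.e. $p^{-1}(U)$ is a disjoint union of open subsets of $\widetilde{X}$ each mapped homeomorphically onto $U$ by $p$. All spaces and covering spaces are path connected; homotopies of paths are relative to endpoints. Unbased Spanier group: for an open cover $\mathcal{U}$ of $X$, $\pi(\mathcal{U},x)\le\pi_1(X,x)$ is the subgroup of classes having a representative of the form $\prod_{j=1}^n u_j v_j u_j^{-1}$, with $u_j$ a path starting at $x$ and $v_j$ a loop based at $u_j(1)$ lying inside some $U_j\in\mathcal{U}$. Then $\pi_1^{sp}(X,x)=\bigcap_{\mathcal{U}}\pi(\mathcal{U},x)$ over all open covers $\mathcal{U}$. Based Spanier group: let $\mathcal{V}=\{(V_i,x_i)\mid i\in I\}$ be a cover of $X$ by open neighborhood pairs ($V_i$ open, $x_i\in V_i$, every point of $X$ occurring as some $x_i$). Then $\pi^*(\mathcal{V},x)\le \pi_1(X,x)$ is the subgroup of classes having a representative $\prod_{j=1}^n u_jv_ju_j^{-1}$ where each $u_j$ is a path from $x$ to some point $x_i$ and $v_j$ is a loop based at $x_i$ inside the corresponding $V_i$. Then $\pi_1^{bsp}(X,x)=\bigcap_{\mathcal{V}}\pi^*(\mathcal{V},x)$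 over all such covers $\mathcal{V}$. *)

theory Defs
  imports "HOL-Analysis.Analysis" "HOL-Algebra.Group"
begin

section \<open>The fundamental group\<close>

text \<open>
  A space is a subset of a topological type with the subspace topology, as for the library's
  \<^const>\<open>covering_space\<close>.  A path is a function on all of the reals of which only the restriction
  to the unit interval matters, so a homotopy class contains all functions that agree on the unit
  interval with one of its members.
\<close>

definition path_class :: "'a::topological_space set \<Rightarrow> (real \<Rightarrow> 'a) \<Rightarrow> (real \<Rightarrow> 'a) set"
  where "path_class X f = {g. homotopic_paths X f g}"

definition loops_at :: "'a::topological_space set \<Rightarrow> 'a \<Rightarrow> (real \<Rightarrow> 'a) set"
  where "loops_at X x = {f. path f \<and> path_image f \<subseteq> X \<and> pathstart f = x \<and> pathfinish f = x}"

text \<open>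
  The constant path is written out because \<^const>\<open>linepath\<close> is only available in normed spaces.
\<close>

definition fundamental_group ::
    "'a::topological_space set \<Rightarrow> 'a \<Rightarrow> (real \<Rightarrow> 'a) set monoid"
  where "fundamental_group X x =
    \<lparr>carrier = path_class X ` loops_at X x,
     mult = (\<lambda>A B. {h. \<exists>f\<in>A. \<exists>g\<in>B. homotopic_paths X (f +++ g) h}),
     one = path_class X (\<lambda>_. x)\<rparr>"

text \<open>
  The map induced on homotopy classes by a map \<open>p\<close> into \<open>X\<close>.  For \<open>p\<close> continuous it sends
  the class of \<open>g\<close> to that of \<open>p \<circ> g\<close>, see \<open>induced_map_path_class\<close> below.
\<close>

definition induced_map ::
    "'a::topological_space set \<Rightarrow> ('b \<Rightarrow> 'a) \<Rightarrow> (real \<Rightarrow> 'b) set \<Rightarrow> (real \<Rightarrow> 'a) set"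
  where "induced_map X p A = {h. \<exists>g\<in>A. homotopic_paths X (p \<circ> g) h}"


section \<open>Spanier groups\<close>

definition open_cover :: "'a::topological_space set \<Rightarrow> 'a set set \<Rightarrow> bool"
  where "open_cover X \<U> \<longleftrightarrow> (\<forall>U\<in>\<U>. openin (top_of_set X) U) \<and> \<Union>\<U> = X"

definition pointed_open_cover :: "'a::topological_space set \<Rightarrow> ('a set \<times> 'a) set \<Rightarrow> bool"
  where "pointed_open_cover X \<V> \<longleftrightarrow>
    (\<forall>(V, y)\<in>\<V>. openin (top_of_set X) V \<and> y \<in> V) \<and> snd ` \<V> = X"

text \<open>
  The product \<open>\<Prod>\<^sub>j u\<^sub>j v\<^sub>j u\<^sub>j\<inverse>\<close> of a list of pairs \<open>(u\<^sub>j, v\<^sub>j)\<close>.  The empty product is the constant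
  path at \<open>x\<close>, and a nonempty product is followed by this constant path, which does not change
  its homotopy class.
\<close>

definition conj_prod :: "'a::topological_space \<Rightarrow> ((real \<Rightarrow> 'a) \<times> (real \<Rightarrow> 'a)) list \<Rightarrow> real \<Rightarrow> 'a"
  where "conj_prod x uvs = foldr (\<lambda>(u, v) f. (u +++ v +++ reversepath u) +++ f) uvs (\<lambda>_. x)"

definition spanier_group_cover ::
    "'a::topological_space set \<Rightarrow> 'a set set \<Rightarrow> 'a \<Rightarrow> (real \<Rightarrow> 'a) set set"
  where "spanier_group_cover X \<U> x = {path_class X (conj_prod x uvs) | uvs.
    \<forall>(u, v)\<in>set uvs. path u \<and> path_image u \<subseteq> X \<and> pathstart u = x \<and>
      (\<exists>U\<in>\<U>. v \<in> loops_at U (pathfinish u))}"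

definition spanier_group :: "'a::topological_space set \<Rightarrow> 'a \<Rightarrow> (real \<Rightarrow> 'a) set set"
  where "spanier_group X x = (\<Inter>\<U>\<in>{\<U>. open_cover X \<U>}. spanier_group_cover X \<U> x)"

definition based_spanier_group_cover ::
    "'a::topological_space set \<Rightarrow> ('a set \<times> 'a) set \<Rightarrow> 'a \<Rightarrow> (real \<Rightarrow> 'a) set set"
  where "based_spanier_group_cover X \<V> x = {path_class X (conj_prod x uvs) | uvs.
    \<forall>(u, v)\<in>set uvs. path u \<and> path_image u \<subseteq> X \<and> pathstart u = x \<and>
      (\<exists>(V, y)\<in>\<V>. pathfinish u = y \<and> v \<in> loops_at V y)}"

definition based_spanier_group :: "'a::topological_space set \<Rightarrow> 'a \<Rightarrow> (real \<Rightarrow> 'a) set set"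
  where "based_spanier_group X x =
    (\<Inter>\<V>\<in>{\<V>. pointed_open_cover X \<V>}. based_spanier_group_cover X \<V> x)"


section \<open>Sanity checks\<close>

lemma path_class_eq_iff:
  assumes "path f" "path_image f \<subseteq> X"
  shows "path_class X f = path_class X g \<longleftrightarrow> homotopic_paths X f g"
proof
  assume "path_class X f = path_class X g"
  then have "homotopic_paths X g f"
    using assms by (metis homotopic_paths_refl mem_Collect_eq path_class_def)
  then show "homotopic_paths X f g" by (rule homotopic_paths_sym)
next
  assume h: "homotopic_paths X f g"
  show "path_class X f = path_class X g"
    unfolding path_class_def
    using homotopic_paths_trans[OF h] homotopic_paths_trans[OF homotopic_paths_sym[OF h]] by blast
qed

lemma path_const_point: "path (\<lambda>_. x)"
  by (simp add: path_def)

lemma const_in_loops_at: "x \<in> X \<Longrightarrow> (\<lambda>_. x) \<in> loops_at X x"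
  by (auto simp: loops_at_def path_const_point path_image_def pathstart_def pathfinish_def)

lemma join_in_loops_at: "f \<in> loops_at X x \<Longrightarrow> g \<in> loops_at X x \<Longrightarrow> f +++ g \<in> loops_at X x"
  by (simp add: loops_at_def subset_path_image_join)

lemma reverse_in_loops_at: "f \<in> loops_at X x \<Longrightarrow> reversepath f \<in> loops_at X x"
  by (simp add: loops_at_def)

lemma fundamental_group_mult:
  assumes "f \<in> loops_at X x" "g \<in> loops_at X x"
  shows "path_class X f \<otimes>\<^bsub>fundamental_group X x\<^esub> path_class X g = path_class X (f +++ g)"
proof -
  have fg: "pathfinish f = pathstart g" and f: "path f" "path_image f \<subseteq> X"
    and g: "path g" "path_image g \<subseteq> X"
    using assms by (auto simp: loops_at_def)
  have "homotopic_paths X (f +++ g) h"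
    if "homotopic_paths X f f'" "homotopic_paths X g g'" "homotopic_paths X (f' +++ g') h" for f' g' h
    using homotopic_paths_trans[OF homotopic_paths_join[OF that(1,2) fg] that(3)] .
  moreover have "homotopic_paths X f f" "homotopic_paths X g g"
    using f g by simp_all
  ultimately show ?thesis
    unfolding fundamental_group_def path_class_def monoid.simps by blast
qed

lemma homotopic_paths_const_right:
  assumes "path f" "path_image f \<subseteq> X" "pathfinish f = x"
  shows "homotopic_paths X (f +++ (\<lambda>_. x)) f"
proof -
  have "continuous_on {0..1} (\<lambda>t::real. min (2 * t) 1)"
    by (intro continuous_intros)
  then show ?thesis
    using assms
    by (intro homotopic_paths_sym[OF homotopic_paths_reparametrize[where f = "\<lambda>t. min (2 * t) 1"]])
       (auto simp: joinpaths_def pathfinish_def min_def)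
qed

lemma homotopic_paths_const_left:
  assumes "path f" "path_image f \<subseteq> X" "pathstart f = x"
  shows "homotopic_paths X ((\<lambda>_. x) +++ f) f"
proof -
  have "continuous_on {0..1} (\<lambda>t::real. max (2 * t - 1) 0)"
    by (intro continuous_intros)
  then show ?thesis
    using assms
    by (intro homotopic_paths_sym[OF homotopic_paths_reparametrize[where f = "\<lambda>t. max (2 * t - 1) 0"]])
       (auto simp: joinpaths_def pathstart_def max_def)
qed

lemma homotopic_paths_reverse_left:
  assumes "path f" "path_image f \<subseteq> X" "pathfinish f = x"
  shows "homotopic_paths X (reversepath f +++ f) (\<lambda>_. x)"
proof -
  define k where "k = (\<lambda>(s::real, t::real). f (1 - (1 - s) * (1 - \<bar>2 * t - 1\<bar>)))"
  have f: "continuous_on {0..1} f"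
    using assms by (simp add: path_def)
  have b: "0 \<le> 1 - (1 - s) * (1 - \<bar>2 * t - 1\<bar>) \<and> 1 - (1 - s) * (1 - \<bar>2 * t - 1\<bar>) \<le> 1"
    if "0 \<le> s" "s \<le> 1" "0 \<le> t" "t \<le> 1" for s t :: real
  proof -
    have "0 \<le> 1 - \<bar>2 * t - 1\<bar>" "1 - \<bar>2 * t - 1\<bar> \<le> 1" using that by auto
    then show ?thesis using that mult_le_one[of "1 - s" "1 - \<bar>2 * t - 1\<bar>"] by auto
  qed
  have c: "continuous_on ({0..1} \<times> {0..1}) k"
    unfolding k_def case_prod_unfold
    by (rule continuous_on_compose2[OF f]) (use b in \<open>auto intro!: continuous_intros\<close>)
  show ?thesis
    unfolding homotopic_paths
  proof (intro exI[of _ k] conjI ballI)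
    show "k \<in> {0..1} \<times> {0..1} \<rightarrow> X"
      using b assms(2) by (fastforce simp: k_def path_image_def)
  next
    fix t :: real assume "t \<in> {0..1}"
    then show "k (0, t) = (reversepath f +++ f) t"
      by (cases "2 * t = 1") (auto simp: k_def joinpaths_def reversepath_def abs_if eq_divide_eq)
  qed (use c assms(3) in \<open>auto simp: k_def pathstart_def pathfinish_def joinpaths_def reversepath_def\<close>)
qed

lemma group_fundamental_group:
  assumes x: "x \<in> X"
  shows "group (fundamental_group X x)"
proof (rule groupI)
  let ?G = "fundamental_group X x"
  have car: "carrier ?G = path_class X ` loops_at X x"
    and one: "\<one>\<^bsub>?G\<^esub> = path_class X (\<lambda>_. x)"
    by (simp_all add: fundamental_group_def)
  note m = fundamental_group_mult join_in_loops_at const_in_loops_at[OF x] reverse_in_loops_at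
  show "\<one>\<^bsub>?G\<^esub> \<in> carrier ?G"
    using const_in_loops_at[OF x] by (simp add: car one)
  show "A \<otimes>\<^bsub>?G\<^esub> B \<in> carrier ?G" if "A \<in> carrier ?G" "B \<in> carrier ?G" for A B
    using that by (auto simp: car m)
  show "A \<otimes>\<^bsub>?G\<^esub> B \<otimes>\<^bsub>?G\<^esub> C = A \<otimes>\<^bsub>?G\<^esub> (B \<otimes>\<^bsub>?G\<^esub> C)"
    if "A \<in> carrier ?G" "B \<in> carrier ?G" "C \<in> carrier ?G" for A B C
  proof -
    from that obtain f g h where L: "f \<in> loops_at X x" "g \<in> loops_at X x" "h \<in> loops_at X x"
      and e: "A = path_class X f" "B = path_class X g" "C = path_class X h"
      unfolding car by blast
    have "homotopic_paths X (f +++ (g +++ h)) ((f +++ g) +++ h)"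
      using L by (intro homotopic_paths_assoc) (auto simp: loops_at_def)
    then have "path_class X (f +++ (g +++ h)) = path_class X ((f +++ g) +++ h)"
      by (meson homotopic_paths_imp_path homotopic_paths_imp_subset path_class_eq_iff)
    then show ?thesis using L by (simp add: e m)
  qed
  show "\<one>\<^bsub>?G\<^esub> \<otimes>\<^bsub>?G\<^esub> A = A" if "A \<in> carrier ?G" for A
  proof -
    from that obtain f where L: "f \<in> loops_at X x" and e: "A = path_class X f"
      unfolding car by blast
    have h: "homotopic_paths X ((\<lambda>_. x) +++ f) f"
      using L by (intro homotopic_paths_const_left) (auto simp: loops_at_def)
    then have "path_class X ((\<lambda>_. x) +++ f) = path_class X f"
      by (meson homotopic_paths_imp_path homotopic_paths_imp_subset path_class_eq_iff)
    then show ?thesis using L by (simp add: e one m)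
  qed
  show "\<exists>B\<in>carrier ?G. B \<otimes>\<^bsub>?G\<^esub> A = \<one>\<^bsub>?G\<^esub>" if "A \<in> carrier ?G" for A
  proof -
    from that obtain f where L: "f \<in> loops_at X x" and e: "A = path_class X f"
      unfolding car by blast
    have h: "homotopic_paths X (reversepath f +++ f) (\<lambda>_. x)"
      using L by (intro homotopic_paths_reverse_left) (auto simp: loops_at_def)
    then have "path_class X (reversepath f +++ f) = path_class X (\<lambda>_. x)"
      by (meson homotopic_paths_imp_path homotopic_paths_imp_subset path_class_eq_iff)
    then show ?thesis using L 
      by (intro bexI[of _ "path_class X (reversepath f)"]) (simp_all add: e one m car)
  qed
qed

lemma induced_map_path_class:
  assumes "continuous_on Y p" "p ` Y \<subseteq> X" "path g" "path_image g \<subseteq> Y"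
  shows "induced_map X p (path_class Y g) = path_class X (p \<circ> g)"
proof -
  have hom: "homotopic_paths X (p \<circ> g) (p \<circ> g')" if "homotopic_paths Y g g'" for g'
    using homotopic_paths_continuous_image[OF that assms(1)] assms(2) by blast
  have "homotopic_paths X (p \<circ> g) h"
    if "homotopic_paths Y g g'" "homotopic_paths X (p \<circ> g') h" for g' h
    using homotopic_paths_trans[OF hom[OF that(1)] that(2)] .
  moreover have "homotopic_paths Y g g"
    using assms by simp
  ultimately show ?thesis
    unfolding induced_map_def path_class_def by blast
qed

text \<open>
  The definition of \<^const>\<open>covering_space\<close> includes surjectivity.  Over a connected base this is
  automatic when the total space is nonempty.
\<close>

lemma covering_space_if_connected:
  assumes X: "connected X" and Y: "Y \<noteq> {}" and p: "continuous_on Y p" "p ` Y \<subseteq> X"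
    and ev: "\<And>x. x \<in> X \<Longrightarrow> \<exists>T. x \<in> T \<and> openin (top_of_set X) T \<and>
      (\<exists>v. \<Union>v = Y \<inter> p -` T \<and> (\<forall>u\<in>v. openin (top_of_set Y) u) \<and> pairwise disjnt v \<and>
           (\<forall>u\<in>v. \<exists>q. homeomorphism u T p q))"
  shows "covering_space Y p X"
proof -
  have nb: "\<exists>T. x \<in> T \<and> openin (top_of_set X) T \<and> (T \<subseteq> p ` Y \<or> T \<inter> p ` Y = {})" if x: "x \<in> X" for x
  proof -
    obtain T v where T: "x \<in> T" "openin (top_of_set X) T" "\<Union>v = Y \<inter> p -` T"
        "\<forall>u\<in>v. \<exists>q. homeomorphism u T p q"
      using ev[OF x] by metis
    show ?thesis
    proof (cases "v = {}")
      case True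
      then have "T \<inter> p ` Y = {}" using T(3) by auto
      then show ?thesis using T(1,2) by metis
    next
      case False
      then obtain u where u: "u \<in> v" by blast
      then have "p ` u = T" "u \<subseteq> Y" using T(3,4) unfolding homeomorphism_def by (metis, blast)
      then have "T \<subseteq> p ` Y" using image_mono[of u Y p] by simp
      then show ?thesis using T(1,2) by metis
    qed
  qed
  have op: "openin (top_of_set X) (p ` Y)"
  proof (subst openin_subopen, intro ballI)
    fix x assume x: "x \<in> p ` Y"
    then obtain T where "x \<in> T" "openin (top_of_set X) T" "T \<subseteq> p ` Y"
      using nb[OF subsetD[OF p(2) x]] by (metis disjoint_iff)
    then show "\<exists>T. openin (top_of_set X) T \<and> x \<in> T \<and> T \<subseteq> p ` Y"
      by metis
  qed
  have "openin (top_of_set X) (X - p ` Y)"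
  proof (subst openin_subopen, intro ballI)
    fix x assume x: "x \<in> X - p ` Y"
    then obtain T where T: "x \<in> T" "openin (top_of_set X) T" "T \<inter> p ` Y = {}"
      using nb[OF DiffD1[OF x]] by (metis DiffD2 subsetD)
    then have "T \<subseteq> X - p ` Y"
      using openin_imp_subset[OF T(2)] by auto
    with T show "\<exists>T. openin (top_of_set X) T \<and> x \<in> T \<and> T \<subseteq> X - p ` Y"
      by metis
  qed
  then have "closedin (top_of_set X) (p ` Y)"
    using p(2) by (simp add: closedin_def)
  then have "p ` Y = X"
    using X op Y unfolding connected_clopen by (metis image_is_empty)
  then show ?thesis
    unfolding covering_space_def using p(1) ev by simp
qed

end

theory Submission
  imports Defs
begin

text \<open>
  A cover by pointed neighbourhoods refines to all pairs \<open>(U, y)\<close> with \<open>y \<in> U\<close> and \<open>U\<close> from a given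
  open cover, which gives the first inclusion.  For the second, take the cover of the base by evenly
  covered sets.  If \<open>v\<close> is a loop inside an evenly covered set, a lift of \<open>u\<close> from \<open>xt\<close> can be followed by
  the image of \<open>v\<close> under the local section through its endpoint.  This is again a loop, so
  \<open>u v u\<inverse>\<close> lifts to a loop at \<open>xt\<close>.  Only existence of path lifts is needed, not
  uniqueness or homotopy lifting.
\<close>

section \<open>Path lifting\<close>

text \<open>
  The lifting theorems of the library assume that the total space lies in a normed space.
\<close>

definition has_local_sections ::
    "'b::topological_space set \<Rightarrow> ('b \<Rightarrow> 'a::topological_space) \<Rightarrow> 'a set \<Rightarrow> bool"
  where "has_local_sections Y p T \<longleftrightarrow> (\<forall>e\<in>Y. p e \<in> T \<longrightarrow>
    (\<exists>q. continuous_on T q \<and> q ` T \<subseteq> Y \<and> (\<forall>z\<in>T. p (q z) = z) \<and> q (p e) = e))"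

text \<open>Agreement is asked only on the unit interval, so \<open>p \<circ> h\<close> and
  \<open>g\<close> are compared up to homotopy rather than as functions.\<close>

definition lifts_to :: "'b::topological_space set \<Rightarrow> ('b \<Rightarrow> 'a) \<Rightarrow> (real \<Rightarrow> 'a) \<Rightarrow> (real \<Rightarrow> 'b) \<Rightarrow> bool"
  where "lifts_to Y p g h \<longleftrightarrow> path h \<and> path_image h \<subseteq> Y \<and> (\<forall>t\<in>{0..1}. p (h t) = g t)"

text \<open>The section through \<open>e\<close> is the inverse of the homeomorphism on the sheet
  that contains \<open>e\<close>.\<close>

lemma covering_space_has_local_sections:
  assumes "covering_space Y p X" "x \<in> X"
  obtains T where "x \<in> T" "openin (top_of_set X) T" "has_local_sections Y p T"
proof -
  obtain T v where T: "x \<in> T" "openin (top_of_set X) T" "\<Union>v = Y \<inter> p -` T"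
      "\<forall>u\<in>v. \<exists>q. homeomorphism u T p q"
    using assms unfolding covering_space_def by metis
  have "\<exists>q. continuous_on T q \<and> q ` T \<subseteq> Y \<and> (\<forall>z\<in>T. p (q z) = z) \<and> q (p e) = e"
    if e: "e \<in> Y" "p e \<in> T" for e
  proof -
    obtain u where u: "u \<in> v" "e \<in> u"
      using e T(3) by blast
    then obtain q where q: "homeomorphism u T p q"
      using T(4) by blast
    have "u \<subseteq> Y" using u T(3) by blast
    then show ?thesis
      using q u(2) unfolding homeomorphism_def by (intro exI[of _ q]) auto
  qed
  then have "has_local_sections Y p T"
    unfolding has_local_sections_def by blast
  then show thesis using that T(1,2) by blast
qed

text \<open>Bisection of the unit interval: lifts over adjacent intervals can be glued, and over a
  short interval \<open>g\<close> stays in a set with local sections.\<close>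

lemma path_lift_exists:
  fixes p :: "'b::topological_space \<Rightarrow> 'a::topological_space"
  assumes cov: "covering_space Y p X" and g: "path g" "path_image g \<subseteq> X"
    and e: "e \<in> Y" "p e = pathstart g"
  obtains h where "lifts_to Y p g h" "pathstart h = e"
proof -
  \<comment> \<open>All starting points over \<open>g a\<close> are allowed, so that a second lift
    can start where the first one ends. The bounds make \<open>P a b\<close> trivial for intervals
    that leave the unit interval, which the local case of \<open>Bolzano\<close> includes.\<close>
  define P where "P a b \<longleftrightarrow> (\<forall>e\<in>Y. 0 \<le> a \<longrightarrow> a \<le> b \<longrightarrow> b \<le> 1 \<longrightarrow> p e = g a \<longrightarrow>
      (\<exists>h. continuous_on {a..b} h \<and> h ` {a..b} \<subseteq> Y \<and> h a = e \<and> (\<forall>t\<in>{a..b}. p (h t) = g t)))"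
    for a b :: real
  have contg: "continuous_on {0..1} g"
    using g(1) by (simp add: path_def)
  have "P 0 1"
    using zero_le_one
  proof (induction rule: Bolzano)
    case (trans a b c)
    show ?case unfolding P_def
    proof (intro ballI impI)
      fix e assume e: "e \<in> Y" "0 \<le> a" "a \<le> c" "c \<le> 1" "p e = g a"
      then obtain h where h: "continuous_on {a..b} h" "h ` {a..b} \<subseteq> Y" "h a = e"
          "\<forall>t\<in>{a..b}. p (h t) = g t"
        using trans unfolding P_def by (meson order_trans)
      have "h b \<in> Y" "p (h b) = g b"
        using h trans by auto
      then obtain k where k: "continuous_on {b..c} k" "k ` {b..c} \<subseteq> Y" "k b = h b"
          "\<forall>t\<in>{b..c}. p (k t) = g t"
        using trans e unfolding P_def by (meson order_trans)
      let ?f = "\<lambda>t. if t \<le> b then h t else k t"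
      have "continuous_on {a..c} ?f"
        using trans k(3)
        by (intro continuous_on_cases_1 continuous_on_subset[OF h(1)] continuous_on_subset[OF k(1)]) auto
      moreover have "?f ` {a..c} \<subseteq> Y" "?f a = e" "\<forall>t\<in>{a..c}. p (?f t) = g t"
        using h k trans by (auto simp: image_subset_iff)
      ultimately show "\<exists>h. continuous_on {a..c} h \<and> h ` {a..c} \<subseteq> Y \<and> h a = e \<and>
          (\<forall>t\<in>{a..c}. p (h t) = g t)"
        by blast
    qed
  next
    case (local s)
    then have "g s \<in> X" using g(2) by (auto simp: path_image_def)
    then obtain T where T: "g s \<in> T" "openin (top_of_set X) T" "has_local_sections Y p T"
      using covering_space_has_local_sections[OF cov] by blast
    obtain W where W: "open W" "T = X \<inter> W"
      using T(2) by (auto simp: openin_open)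
    have "\<forall>\<^sub>F t in at s within {0..1}. g t \<in> W"
      using contg local T(1) W by (auto simp: continuous_on_def intro: topological_tendstoD)
    then obtain d where d: "d > 0" "\<And>t. t \<in> {0..1} \<Longrightarrow> dist t s < d \<Longrightarrow> g t \<in> W"
      using T(1) W unfolding eventually_at by (metis IntD2)
    have "P a b" if ab: "a \<le> s" "s \<le> b" "b - a < d" for a b
      unfolding P_def
    proof (intro ballI impI)
      fix e assume e: "e \<in> Y" "0 \<le> a" "a \<le> b" "b \<le> 1" "p e = g a"
      \<comment> \<open>Both \<open>s\<close> and \<open>t\<close> lie in \<open>{a..b}\<close>,
        which is shorter than \<open>d\<close>, so \<open>t\<close> is within \<open>d\<close> of
        \<open>s\<close>.\<close>
      have gT: "g ` {a..b} \<subseteq> T"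
        using d(2) ab e g(2) by (auto simp: W path_image_def dist_real_def)
      then have "p e \<in> T" using e by auto
      then obtain q where q: "continuous_on T q" "q ` T \<subseteq> Y" "\<forall>z\<in>T. p (q z) = z" "q (p e) = e"
        using T(3) e(1) unfolding has_local_sections_def by blast
      have "continuous_on {a..b} (q \<circ> g)"
        using gT e
        by (intro continuous_on_compose continuous_on_subset[OF q(1)] continuous_on_subset[OF contg]) auto
      then show "\<exists>h. continuous_on {a..b} h \<and> h ` {a..b} \<subseteq> Y \<and> h a = e \<and> (\<forall>t\<in>{a..b}. p (h t) = g t)"
        using gT q e by (intro exI[of _ "q \<circ> g"]) (auto simp: image_subset_iff)
    qed
    then show ?case using d(1) by blast
  qed
  then obtain h where "continuous_on {0..1} h" "h ` {0..1} \<subseteq> Y" "h 0 = e"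
      "\<forall>t\<in>{0..1}. p (h t) = g t"
    using e unfolding P_def pathstart_def by (metis order_refl zero_le_one)
  then show thesis
    by (intro that[of h]) (auto simp: lifts_to_def path_def path_image_def pathstart_def)
qed

section \<open>Lifts of products of conjugates\<close>

lemma lifts_to_join:
  assumes "lifts_to Y p f h" "lifts_to Y p g k" "pathfinish h = pathstart k"
  shows "lifts_to Y p (f +++ g) (h +++ k)"
  using assms by (simp add: lifts_to_def subset_path_image_join) (simp add: joinpaths_def)

lemma lifts_to_reversepath:
  "lifts_to Y p g h \<Longrightarrow> lifts_to Y p (reversepath g) (reversepath h)"
  by (simp add: lifts_to_def) (simp add: reversepath_def)

lemma lifts_to_homotopic_paths:
  assumes "lifts_to Y p g h" "continuous_on Y p" "p ` Y \<subseteq> X"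
  shows "homotopic_paths X (p \<circ> h) g"
proof (rule homotopic_paths_eq)
  show "path (p \<circ> h)"
    using assms by (intro path_continuous_image continuous_on_subset[OF assms(2)]) (auto simp: lifts_to_def)
  show "path_image (p \<circ> h) \<subseteq> X"
    using assms by (auto simp: path_image_compose lifts_to_def)
qed (use assms in \<open>simp add: lifts_to_def\<close>)

text \<open>Induction on the list. The lift of each factor returns to \<open>e\<close> along the
  reverse of the very lift \<open>k\<close> on which it left, so the loop lifting the remaining
  product can follow.\<close>

lemma conj_prod_lifts_to_loop:
  fixes p :: "'b::topological_space \<Rightarrow> 'a::topological_space"
  assumes cov: "covering_space Y p X" and e: "e \<in> Y" "p e = x"
    and uvs: "\<forall>(u, v)\<in>set uvs. path u \<and> path_image u \<subseteq> X \<and> pathstart u = x \<and>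
      (\<exists>T. has_local_sections Y p T \<and> v \<in> loops_at T (pathfinish u))"
  shows "\<exists>h\<in>loops_at Y e. lifts_to Y p (conj_prod x uvs) h"
  using uvs
proof (induction uvs)
  case Nil
  have "(\<lambda>_. e) \<in> loops_at Y e" "lifts_to Y p (conj_prod x []) (\<lambda>_. e)"
    using const_in_loops_at[OF e(1)] e by (auto simp: conj_prod_def lifts_to_def loops_at_def)
  then show ?case by blast
next
  case (Cons uv uvs)
  obtain u v where uv: "uv = (u, v)" by (cases uv)
  obtain T where u: "path u" "path_image u \<subseteq> X" "pathstart u = x"
    and T: "has_local_sections Y p T" and v: "v \<in> loops_at T (pathfinish u)"
    using Cons.prems uv by auto
  obtain h where h: "h \<in> loops_at Y e" "lifts_to Y p (conj_prod x uvs) h"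
    using Cons by auto
  obtain k where k: "lifts_to Y p u k" "pathstart k = e"
    using path_lift_exists[OF cov u(1,2)] e u(3) by metis
  have pk: "p (pathfinish k) = pathfinish u" "pathfinish k \<in> Y"
    using k(1) by (auto simp: lifts_to_def pathfinish_def path_image_def)
  have "pathfinish u \<in> T"
    using v by (auto simp: loops_at_def)
  then obtain q where q: "continuous_on T q" "q ` T \<subseteq> Y" "\<forall>z\<in>T. p (q z) = z"
      "q (pathfinish u) = pathfinish k"
    using T pk unfolding has_local_sections_def by metis
  have vT: "path v" "path_image v \<subseteq> T"
    using v by (auto simp: loops_at_def)
  then have "path (q \<circ> v)"
    by (intro path_continuous_image continuous_on_subset[OF q(1)])
  then have qv: "lifts_to Y p v (q \<circ> v)"
    using vT q by (auto simp: lifts_to_def path_image_def image_subset_iff)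
  \<comment> \<open>Both ends of \<open>v\<close> are \<open>pathfinish u\<close>, and
    \<open>q\<close> sends this point to \<open>pathfinish k\<close>; an image of a loop under a
    single section is closed.\<close>
  have ends: "pathstart (q \<circ> v) = pathfinish k" "pathfinish (q \<circ> v) = pathfinish k"
    using v q(4) by (auto simp: pathstart_compose pathfinish_compose loops_at_def)
  let ?h = "(k +++ (q \<circ> v) +++ reversepath k) +++ h"
  have "lifts_to Y p (conj_prod x (uv # uvs)) ?h"
    unfolding uv conj_prod_def foldr.simps comp_def case_prod_conv
    using h k qv ends
    by (intro lifts_to_join lifts_to_reversepath)
       (auto simp: conj_prod_def comp_def loops_at_def)
  moreover from this have "?h \<in> loops_at Y e"
    using h k ends by (auto simp: loops_at_def lifts_to_def)
  ultimately show ?case by blast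
qed

section \<open>Subgroups\<close>

lemma path_class_homotopic:
  "homotopic_paths X f g \<Longrightarrow> path_class X f = path_class X g"
  by (meson homotopic_paths_imp_path homotopic_paths_imp_subset path_class_eq_iff)

lemma one_fundamental_group: "\<one>\<^bsub>fundamental_group X x\<^esub> = path_class X (\<lambda>_. x)"
  by (simp add: fundamental_group_def)

lemma path_class_in_carrier: "f \<in> loops_at X x \<Longrightarrow> path_class X f \<in> carrier (fundamental_group X x)"
  by (simp add: fundamental_group_def)

text \<open>In a group a left inverse is the inverse, so contracting
  \<open>reversepath f +++ f\<close> is enough.\<close>

lemma fundamental_group_inv:
  assumes x: "x \<in> X" and f: "f \<in> loops_at X x"
  shows "inv\<^bsub>fundamental_group X x\<^esub> path_class X f = path_class X (reversepath f)"
proof -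
  interpret group "fundamental_group X x" by (rule group_fundamental_group[OF x])
  have "homotopic_paths X (reversepath f +++ f) (\<lambda>_. x)"
    using f by (intro homotopic_paths_reverse_left) (auto simp: loops_at_def)
  then show ?thesis
    using f reverse_in_loops_at[OF f]
    by (intro inv_equality)
       (simp_all add: fundamental_group_mult one_fundamental_group path_class_in_carrier path_class_homotopic)
qed

text \<open>On representatives the map is composition with \<open>p\<close>, which commutes with
  joining paths.\<close>

lemma induced_map_hom:
  assumes p: "continuous_on Y p" "p ` Y \<subseteq> X" and y: "y \<in> Y"
  shows "group_hom (fundamental_group Y y) (fundamental_group X (p y)) (induced_map X p)"
proof -
  have L: "p \<circ> f \<in> loops_at X (p y)" if "f \<in> loops_at Y y" for f
  proof -
    have "path (p \<circ> f)"
      using that by (intro path_continuous_image continuous_on_subset[OF p(1)]) (auto simp: loops_at_def)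
    then show ?thesis
      using that p(2) by (auto simp: loops_at_def path_image_compose pathstart_compose pathfinish_compose)
  qed
  have I: "induced_map X p (path_class Y f) = path_class X (p \<circ> f)" if "f \<in> loops_at Y y" for f
    using that p by (intro induced_map_path_class) (auto simp: loops_at_def)
  have "induced_map X p \<in> hom (fundamental_group Y y) (fundamental_group X (p y))"
  proof (rule homI)
    fix A assume "A \<in> carrier (fundamental_group Y y)"
    then show "induced_map X p A \<in> carrier (fundamental_group X (p y))"
      using L I by (auto simp: fundamental_group_def)
  next
    fix A B assume "A \<in> carrier (fundamental_group Y y)" "B \<in> carrier (fundamental_group Y y)"
    then obtain f g where "f \<in> loops_at Y y" "g \<in> loops_at Y y" "A = path_class Y f" "B = path_class Y g"
      by (auto simp: fundamental_group_def)
    then show "induced_map X p (A \<otimes>\<^bsub>fundamental_group Y y\<^esub> B) =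
        induced_map X p A \<otimes>\<^bsub>fundamental_group X (p y)\<^esub> induced_map X p B"
      by (simp add: I L join_in_loops_at fundamental_group_mult path_compose_join)
  qed
  then show ?thesis
    using group_fundamental_group[OF y] group_fundamental_group[of "p y" X] p(2) y
    by (auto simp: group_hom_def group_hom_axioms_def)
qed

section \<open>Subgroups of products of conjugates\<close>

text \<open>Treats both kinds of Spanier group at once, with \<open>Q\<close> as the condition on a
  pair. Appending lists multiplies classes; reversing a list and each \<open>v\<close> in it, with
  every \<open>u\<close> kept, inverts them.\<close>

lemma subgroup_conj_prods:
  fixes X :: "'a::topological_space set"
  assumes x: "x \<in> X"
    and Q: "\<And>u v. Q (u, v) \<Longrightarrow> path u \<and> path_image u \<subseteq> X \<and> pathstart u = x \<and>
      v \<in> loops_at X (pathfinish u) \<and> Q (u, reversepath v)"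
  shows "subgroup {path_class X (conj_prod x uvs) | uvs. \<forall>uv\<in>set uvs. Q uv} (fundamental_group X x)"
    (is "subgroup ?S ?G")
proof -
  interpret G: group ?G by (rule group_fundamental_group[OF x])
  \<comment> \<open>\<open>c uv\<close> is the factor that belongs to a pair, and
    \<open>r uv\<close> is the pair whose factor represents the inverse class.\<close>
  define c where "c = (\<lambda>(u, v). (u +++ v +++ reversepath u) :: real \<Rightarrow> 'a)"
  define r where "r = (\<lambda>(u, v). (u, reversepath v) :: (real \<Rightarrow> 'a) \<times> (real \<Rightarrow> 'a))"
  have c_loop: "c uv \<in> loops_at X x" if "Q uv" for uv
  proof (cases uv)
    case (Pair u v)
    then show ?thesis
      using that Q[of u v] by (simp add: c_def loops_at_def subset_path_image_join)
  qed
  have Qr: "Q (r uv)" if "Q uv" for uv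
    using that Q by (auto simp: r_def split: prod.splits)
  have conj_Cons: "conj_prod x (uv # uvs) = c uv +++ conj_prod x uvs" for uv uvs
    by (simp add: conj_prod_def c_def split: prod.splits)
  have loop: "conj_prod x uvs \<in> loops_at X x" if "\<forall>uv\<in>set uvs. Q uv" for uvs
    using that const_in_loops_at[OF x]
    by (induction uvs) (simp_all add: conj_Cons c_loop join_in_loops_at, simp add: conj_prod_def)
  have class_Nil: "path_class X (conj_prod x []) = \<one>\<^bsub>?G\<^esub>"
    by (simp add: conj_prod_def one_fundamental_group)
  have class_Cons: "path_class X (conj_prod x (uv # uvs)) =
      path_class X (c uv) \<otimes>\<^bsub>?G\<^esub> path_class X (conj_prod x uvs)"
    if "Q uv" "\<forall>uv\<in>set uvs. Q uv" for uv uvs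
    using that by (simp add: conj_Cons fundamental_group_mult c_loop loop)
  \<comment> \<open>The two sides come from paths that differ in bracketing and in the constant path
    inside the product, so the induction runs in the group.\<close>
  have append: "path_class X (conj_prod x (as @ bs)) =
      path_class X (conj_prod x as) \<otimes>\<^bsub>?G\<^esub> path_class X (conj_prod x bs)"
    if "\<forall>uv\<in>set as. Q uv" "\<forall>uv\<in>set bs. Q uv" for as bs
    using that
  proof (induction as)
    case Nil
    then show ?case by (simp add: class_Nil path_class_in_carrier loop)
  next
    case (Cons a as)
    have "\<forall>uv\<in>set (as @ bs). Q uv" using Cons.prems by auto
    with Cons show ?case
      by (simp add: class_Cons G.m_assoc path_class_in_carrier c_loop loop)
  qed
  have inv_c: "path_class X (c (r uv)) = inv\<^bsub>?G\<^esub> path_class X (c uv)" if q: "Q uv" for uv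
  proof -
    obtain u v where uv: "uv = (u, v)" by (cases uv)
    have L: "path u" "path_image u \<subseteq> X" "pathstart u = x" "v \<in> loops_at X (pathfinish u)"
      using Q q uv by auto
    \<comment> \<open>Reversing \<open>c uv\<close> yields a product bracketed to the left, whereas
      \<open>c (r uv)\<close> is bracketed to the right.\<close>
    then have "homotopic_paths X (u +++ (reversepath v +++ reversepath u))
        ((u +++ reversepath v) +++ reversepath u)"
      by (intro homotopic_paths_assoc) (auto simp: loops_at_def)
    moreover have "reversepath (c uv) = (u +++ reversepath v) +++ reversepath u"
      using L by (simp add: c_def uv reversepath_joinpaths loops_at_def)
    ultimately show ?thesis
      by (simp add: fundamental_group_inv[OF x c_loop[OF q]] path_class_homotopic)
         (simp add: path_class_homotopic c_def r_def uv)
  qed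
  have inv: "path_class X (conj_prod x (rev (map r uvs))) = inv\<^bsub>?G\<^esub> path_class X (conj_prod x uvs)"
    if "\<forall>uv\<in>set uvs. Q uv" for uvs
    using that
  proof (induction uvs)
    case Nil
    then show ?case by (simp add: class_Nil)
  next
    case (Cons a as)
    \<comment> \<open>The reversed list ends in \<open>r a\<close>, so this one-element product is
      appended on the right, as the inverse of a product requires.\<close>
    have "path_class X (conj_prod x [r a]) = inv\<^bsub>?G\<^esub> path_class X (c a)"
      using Cons.prems
      by (simp add: class_Cons Qr class_Nil inv_c path_class_in_carrier c_loop)
    with Cons show ?case
      by (simp add: append Qr class_Cons G.inv_mult_group
          path_class_in_carrier c_loop loop)
  qed
  show ?thesis
  proof (rule subgroup.intro)
    show "?S \<subseteq> carrier ?G"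
      using loop by (auto intro: path_class_in_carrier)
    show "\<one>\<^bsub>?G\<^esub> \<in> ?S"
      using class_Nil by (intro CollectI exI[of _ "[]"]) simp
  next
    fix A B assume "A \<in> ?S" "B \<in> ?S"
    then obtain as bs where "A = path_class X (conj_prod x as)" "\<forall>uv\<in>set as. Q uv"
      "B = path_class X (conj_prod x bs)" "\<forall>uv\<in>set bs. Q uv" by blast
    then show "A \<otimes>\<^bsub>?G\<^esub> B \<in> ?S"
      by (intro CollectI exI[of _ "as @ bs"]) (auto simp: append)
  next
    fix A assume "A \<in> ?S"
    then obtain as where "A = path_class X (conj_prod x as)" "\<forall>uv\<in>set as. Q uv" by blast
    then show "inv\<^bsub>?G\<^esub> A \<in> ?S"
      by (intro CollectI exI[of _ "rev (map r as)"]) (auto simp: inv Qr)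
  qed
qed

lemma loops_at_mono: "U \<subseteq> X \<Longrightarrow> loops_at U y \<subseteq> loops_at X y"
  by (auto simp: loops_at_def)

text \<open>Each cover gives a subgroup because a reversed loop stays in the same member of the
  cover.\<close>

lemma subgroup_spanier_group:
  assumes x: "x \<in> X"
  shows "subgroup (spanier_group X x) (fundamental_group X x)"
proof -
  interpret group "fundamental_group X x" by (rule group_fundamental_group[OF x])
  have "subgroup (spanier_group_cover X \<U> x) (fundamental_group X x)" if "open_cover X \<U>" for \<U>
    unfolding spanier_group_cover_def
  proof (rule subgroup_conj_prods[OF x])
    have sub: "\<And>U. U \<in> \<U> \<Longrightarrow> U \<subseteq> X" using that by (auto simp: open_cover_def)
    show "path u \<and> path_image u \<subseteq> X \<and> pathstart u = x \<and> v \<in> loops_at X (pathfinish u) \<and>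
        (case (u, reversepath v) of (u, v) \<Rightarrow> path u \<and> path_image u \<subseteq> X \<and> pathstart u = x \<and>
          (\<exists>U\<in>\<U>. v \<in> loops_at U (pathfinish u)))"
      if uv: "case (u, v) of (u, v) \<Rightarrow> path u \<and> path_image u \<subseteq> X \<and> pathstart u = x \<and>
          (\<exists>U\<in>\<U>. v \<in> loops_at U (pathfinish u))" for u v
    proof -
      obtain U where "U \<in> \<U>" "v \<in> loops_at U (pathfinish u)" using uv by auto
      then show ?thesis
        using uv subsetD[OF loops_at_mono[OF sub]] reverse_in_loops_at[of v U] by (auto intro!: bexI[of _ U])
    qed
  qed
  \<comment> \<open>The intersection of subgroups needs a nonempty family, and this cover shows that
    there is one.\<close>
  moreover have "open_cover X {X}" by (simp add: open_cover_def)
  ultimately show ?thesis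
    unfolding spanier_group_def by (intro subgroups_Inter) auto
qed

lemma subgroup_based_spanier_group:
  assumes x: "x \<in> X"
  shows "subgroup (based_spanier_group X x) (fundamental_group X x)"
proof -
  interpret group "fundamental_group X x" by (rule group_fundamental_group[OF x])
  have "subgroup (based_spanier_group_cover X \<V> x) (fundamental_group X x)"
    if "pointed_open_cover X \<V>" for \<V>
    unfolding based_spanier_group_cover_def
  proof (rule subgroup_conj_prods[OF x])
    have "openin (top_of_set X) V" if "(V, y) \<in> \<V>" for V y
      using \<open>pointed_open_cover X \<V>\<close> that by (auto simp: pointed_open_cover_def)
    note sub = openin_imp_subset[OF this]
    show "path u \<and> path_image u \<subseteq> X \<and> pathstart u = x \<and> v \<in> loops_at X (pathfinish u) \<and>
        (case (u, reversepath v) of (u, v) \<Rightarrow> path u \<and> path_image u \<subseteq> X \<and> pathstart u = x \<and>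
          (\<exists>(V, y)\<in>\<V>. pathfinish u = y \<and> v \<in> loops_at V y))"
      if uv: "case (u, v) of (u, v) \<Rightarrow> path u \<and> path_image u \<subseteq> X \<and> pathstart u = x \<and>
          (\<exists>(V, y)\<in>\<V>. pathfinish u = y \<and> v \<in> loops_at V y)" for u v
    proof -
      obtain V where "(V, pathfinish u) \<in> \<V>" "v \<in> loops_at V (pathfinish u)" using uv by auto
      then show ?thesis
        using uv subsetD[OF loops_at_mono[OF sub]] reverse_in_loops_at[of v V]
        by (auto intro!: bexI[of _ "(V, pathfinish u)"])
    qed
  qed
  \<comment> \<open>Again a witness that the intersected family is nonempty.\<close>
  moreover have "pointed_open_cover X ({X} \<times> X)"
    by (auto simp: pointed_open_cover_def image_iff)
  ultimately show ?thesis
    unfolding based_spanier_group_def by (intro subgroups_Inter) auto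
qed

section \<open>Inclusions\<close>

lemma based_spanier_group_subset: "based_spanier_group X x \<subseteq> spanier_group X x"
proof -
  have "based_spanier_group X x \<subseteq> spanier_group_cover X \<U> x" if U: "open_cover X \<U>" for \<U>
  proof -
    let ?V = "{(U, y). U \<in> \<U> \<and> y \<in> U}"
    have "snd ` ?V = \<Union>\<U>" by (auto simp: image_iff Bex_def)
    then have "pointed_open_cover X ?V"
      using U by (auto simp: pointed_open_cover_def open_cover_def)
    then have "based_spanier_group X x \<subseteq> based_spanier_group_cover X ?V x"
      unfolding based_spanier_group_def by blast
    \<comment> \<open>The same list serves on both sides: a pair \<open>(V, y)\<close> of
      \<open>?V\<close> has \<open>V \<in> \<U>\<close>, and its base point is
      \<open>pathfinish u\<close>.\<close>
    also have "\<dots> \<subseteq> spanier_group_cover X \<U> x"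
    proof
      fix A assume "A \<in> based_spanier_group_cover X ?V x"
      then obtain uvs where A: "A = path_class X (conj_prod x uvs)"
        and uvs: "\<forall>(u, v)\<in>set uvs. path u \<and> path_image u \<subseteq> X \<and> pathstart u = x \<and>
          (\<exists>(V, y)\<in>?V. pathfinish u = y \<and> v \<in> loops_at V y)"
        unfolding based_spanier_group_cover_def by blast
      have "\<forall>(u, v)\<in>set uvs. path u \<and> path_image u \<subseteq> X \<and> pathstart u = x \<and>
          (\<exists>U\<in>\<U>. v \<in> loops_at U (pathfinish u))"
        using uvs by (auto simp: split_beta)
      then show "A \<in> spanier_group_cover X \<U> x"
        unfolding A spanier_group_cover_def by blast
    qed
    finally show ?thesis .
  qed
  then show ?thesis unfolding spanier_group_def by blast
qed

lemma spanier_group_subset_image: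
  fixes p :: "'b::topological_space \<Rightarrow> 'a::topological_space"
  assumes cov: "covering_space Y p X" and e: "e \<in> Y" "p e = x"
  shows "spanier_group X x \<subseteq> induced_map X p ` carrier (fundamental_group Y e)"
proof
  fix A assume A: "A \<in> spanier_group X x"
  have p: "continuous_on Y p" "p ` Y \<subseteq> X"
    using cov by (auto simp: covering_space_def)
  \<comment> \<open>Membership in the Spanier group is used for this single cover; its sets are the
    ones over which every conjugate lifts to a loop.\<close>
  let ?U = "{T. openin (top_of_set X) T \<and> has_local_sections Y p T}"
  have "X \<subseteq> \<Union>?U"
    using covering_space_has_local_sections[OF cov] by blast
  then have "open_cover X ?U"
    by (auto simp: open_cover_def dest: openin_imp_subset)
  then have "A \<in> spanier_group_cover X ?U x"
    using A unfolding spanier_group_def by blast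
  then obtain uvs where A: "A = path_class X (conj_prod x uvs)"
    and uvs: "\<forall>(u, v)\<in>set uvs. path u \<and> path_image u \<subseteq> X \<and> pathstart u = x \<and>
      (\<exists>U\<in>?U. v \<in> loops_at U (pathfinish u))"
    unfolding spanier_group_cover_def by blast
  obtain h where h: "h \<in> loops_at Y e" "lifts_to Y p (conj_prod x uvs) h"
    using conj_prod_lifts_to_loop[OF cov e, of uvs] uvs by fast
  have "induced_map X p (path_class Y h) = path_class X (p \<circ> h)"
    using h(1) p by (intro induced_map_path_class) (auto simp: loops_at_def)
  \<comment> \<open>The lift \<open>h\<close> projects to \<open>conj_prod x uvs\<close> on the unit
    interval, hence to the same class.\<close>
  also have "\<dots> = A"
    unfolding A using lifts_to_homotopic_paths[OF h(2) p] by (rule path_class_homotopic)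
  finally show "A \<in> induced_map X p ` carrier (fundamental_group Y e)"
    using path_class_in_carrier[OF h(1)] by blast
qed

theorem theorem3p1:
  fixes X :: "'a::topological_space set"
    and Xt :: "'b::topological_space set"
    and p :: "'b \<Rightarrow> 'a"
    and x :: 'a and xt :: 'b
  assumes "covering_space Xt p X"
    and "path_connected X"
    and "path_connected Xt"
    and "x \<in> X"
    and "xt \<in> Xt"
    and "p xt = x"
  shows "subgroup (based_spanier_group X x) (fundamental_group X x)
    \<and> subgroup (spanier_group X x) (fundamental_group X x)
    \<and> subgroup (induced_map X p ` carrier (fundamental_group Xt xt)) (fundamental_group X x)
    \<and> based_spanier_group X x \<subseteq> spanier_group X x
    \<and> spanier_group X x \<subseteq> induced_map X p ` carrier (fundamental_group Xt xt)"
proof -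
  have "continuous_on Xt p" "p ` Xt \<subseteq> X"
    using assms(1) by (auto simp: covering_space_def)
  \<comment> \<open>Provides \<open>img_is_subgroup\<close>, by which the image of the induced map
    is a subgroup; \<open>p xt = x\<close> identifies the base points.\<close>
  then interpret group_hom "fundamental_group Xt xt" "fundamental_group X x" "induced_map X p"
    using induced_map_hom[of Xt p X xt] assms(5,6) by simp
  show ?thesis
    by (intro conjI img_is_subgroup subgroup_based_spanier_group subgroup_spanier_group
        based_spanier_group_subset spanier_group_subset_image assms)
qed

end
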